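(* Let $\mathbb{F}$ be any field, $M \in \mathbb{F}^{r \times n}$, and $A, B \subseteq [n]$ with $|A|=|B|=r$. For any $X \subseteq A \setminus B$ and $Y \subseteq B \setminus A$, $$\mu^{M}_{A, B}(\emptyset, \emptyset) = \sum_{u=\max\{|X|,|Y|\}}^{\operatorname{rank} M[X\cup Y]} \binom{\operatorname{rank} M[X\cup Y]-|A \setminus B|}{\operatorname{rank} M[X\cup Y]-u} \sum_{\substack{U \subseteq A \setminus B,\ |U|=u,\ X \subseteq U \\ V \subseteq B \setminus A,\ |V|=u,\ Y \subseteq V}} \mu^{M}_{A, B}(U, V).$$
   Context: $[n]=\{1,\dots,n\}$. For $J\subseteq[n]$, $M[J]$ is the submatrix of $M$ consisting of the columns indexed by $J$ in increasing order. For $A\subseteq[n]$, $X = \{x_1< \dotsb< x_k\} \subseteq A$ and $Y = \{y_1< \dotsb< y_k\} \subseteq [n] \setminus A$, $M[A; -X, +Y]$ denotes the matrix obtained from $M[A]$ by replacing, for each $i$, column $x_i$ by column $y_i$ placed in the position of $x_i$; similarly $M[B; +X, -Y]$ (for $Y\subseteq B$, $X\cap B=\emptyset$) is obtained from $M[B]$ by replacing column $y_i$ by column $x_i$ in the position of $y_i$. Define $\mu^M_{A,B}(X,Y) := \det M[A; -X, +Y]\cdot\det M[B; +X, -Y]$, so $\mu^M_{A,B}(\emptyset,\emptyset)=\det M[A]\det M[B]$. Binomial coefficients are generalized: for integers $n,k$, $\binom{n}{k} = n(n-1)\cdots(n-k+1)/k!$ if $k\ge 0$ and $0$ if $k<0$;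 these are integers, interpreted in $\mathbb{F}$. *)

theory Defs
  imports "Jordan_Normal_Form.DL_Rank" "Jordan_Normal_Form.DL_Submatrix"
begin

text \<open>
  Columns are numbered from 0, as is usual for the matrix library, so the column index set
  of a matrix with \<open>n\<close> columns is \<open>{..<n}\<close>.
  The term \<open>pick J j\<close> is the \<open>j\<close>-th smallest element of \<open>J\<close>, also counted from 0.
\<close>

definition col_submatrix :: "'a mat \<Rightarrow> nat set \<Rightarrow> 'a mat" where
  "col_submatrix M J = submatrix M UNIV J"

text \<open>
  For finite \<open>X\<close>, \<open>Y\<close> of equal cardinality, \<open>exchange_index X Y\<close> sends the \<open>i\<close>-th smallest
  element of \<open>X\<close> to the \<open>i\<close>-th smallest element of \<open>Y\<close> and fixes everything outside \<open>X\<close>.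
\<close>

definition exchange_index :: "nat set \<Rightarrow> nat set \<Rightarrow> nat \<Rightarrow> nat" where
  "exchange_index X Y j = (if j \<in> X then pick Y (card {x \<in> X. x < j}) else j)"

text \<open>
  The matrix \<open>M[A; -X, +Y]\<close>. The positions remain those of the removed columns: the columns
  are not sorted again after the replacement. The matrix \<open>M[B; +X, -Y]\<close> is
  \<open>col_exchange M B Y X\<close>.
\<close>

definition col_exchange :: "'a mat \<Rightarrow> nat set \<Rightarrow> nat set \<Rightarrow> nat set \<Rightarrow> 'a mat" where
  "col_exchange M A X Y =
     mat (dim_row M) (card A) (\<lambda>(i, j). M $$ (i, exchange_index X Y (pick A j)))"

definition exchange_prod ::
  "'a :: comm_ring_1 mat \<Rightarrow> nat set \<Rightarrow> nat set \<Rightarrow> nat set \<Rightarrow> nat set \<Rightarrow> 'a" where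
  "exchange_prod M A B X Y = det (col_exchange M A X Y) * det (col_exchange M B Y X)"

definition gen_binomial :: "int \<Rightarrow> int \<Rightarrow> int" where
  "gen_binomial n k = 
     (if k < 0 then 0 else (\<Prod>i = 0..<nat k. n - int i) div fact (nat k))"

lemma gen_binomial_of_nat:
  "gen_binomial n (int k) = (\<Prod>i = 0..<k. n - int i) div fact k"
  by (simp add: gen_binomial_def)

text \<open>
  For a natural number \<open>k\<close>, \<open>gen_binomial\<close> is the library constant \<^const>\<open>gbinomial\<close> at
  type \<^typ>\<open>int\<close>. With the imports above, the parser accepts that constant only over fields of
  characteristic 0, hence the forward proof.
\<close>

lemmas gen_binomial_gchoose = trans [OF gen_binomial_of_nat gbinomial_prod_rev [symmetric]]

lemma col_exchange_empty:
  assumes "A \<subseteq> {..<dim_col M}"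
  shows "col_exchange M A {} {} = col_submatrix M A"
proof -
  have "{j. j < dim_col M \<and> j \<in> A} = A"
    using assms by auto
  moreover have "pick UNIV i = i" for i
    by (rule pick_UNIV)
  ultimately show ?thesis
    unfolding col_exchange_def col_submatrix_def submatrix_def exchange_index_def
    by simp
qed

lemma exchange_prod_empty:
  assumes "A \<subseteq> {..<dim_col M}" "B \<subseteq> {..<dim_col M}"
  shows "exchange_prod M A B {} {} = det (col_submatrix M A) * det (col_submatrix M B)"
  using assms by (simp add: exchange_prod_def col_exchange_empty)

end

theory Submission
  imports Defs "Subresultants.More_Homomorphisms"
begin

text \<open>
  Let \<open>k = card (A - B)\<close>, let \<open>s\<close> be the rank of the columns \<open>X \<union> Y\<close> and let \<open>S u\<close> be the inner sum
  for \<open>u\<close>. By generalised Laplace expansion, \<open>D(t) = (\<Sum>u. S u * t ^ u)\<close> is the determinant of a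
  \<open>2r \<times> 2r\<close> matrix whose columns consist of a multiple of a column of \<open>M\<close> above another multiple of
  the same column: for a column \<open>m\<close> these are \<open>(m, -t m)\<close> for \<open>A - B - X\<close>, \<open>(0, -t m)\<close> for \<open>X\<close>,
  \<open>(m, m)\<close> for \<open>B - A - Y\<close> and \<open>(m, 0)\<close> for \<open>Y\<close>. After subtracting the upper half from the lower one,
  and after row operations which make all but \<open>s\<close> rows of the columns \<open>X \<union> Y\<close> of \<open>M\<close> zero, one reads off
  that \<open>D\<close> is divisible by \<open>(1 + t) ^ (k - s)\<close>. If \<open>s < k\<close>, the quotient has degree at most \<open>s\<close>, and
  its coefficient of \<open>t ^ s\<close> is on the one hand the right-hand side of the theorem, by the binomial
  series, and on the other hand the leading coefficient \<open>S k\<close> of \<open>D\<close>, which is the left-hand side.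
  If \<open>s \<ge> k\<close>, only the summand \<open>u = k\<close> is nonzero.
\<close>

subsection \<open>Coefficients of quotients by powers of 1 + t\<close>

lemma gen_binomial_nonneg:
  assumes "0 \<le> n"
  shows "gen_binomial n (int k) = int (nat n choose k)"
proof (cases "k \<le> nat n")
  case True
  have "(\<Prod>i = 0..<k. n - int i) = int (\<Prod>i = 0..<k. nat n - i)"
    unfolding of_nat_prod using True assms by (intro prod.cong) auto
  also have "\<dots> = int (fact k * (nat n choose k))"
  proof -
    have "fact k * fact (nat n - k) * (nat n choose k) = fact (nat n)"
      using binomial_fact_lemma True by blast
    moreover have "(\<Prod>i = 0..<k. nat n - i) * fact (nat n - k) = fact (nat n)"
      using True
    proof (induction k)
      case (Suc k)
      have "fact (nat n - k) = (nat n - k) * (fact (nat n - Suc k) :: nat)"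
        using Suc.prems by (simp add: Suc_diff_Suc[symmetric] algebra_simps)
      then show ?case using Suc by (simp add: ac_simps)
    qed simp
    ultimately have "(\<Prod>i = 0..<k. nat n - i) * fact (nat n - k) = (fact k * (nat n choose k)) * fact (nat n - k)"
      by (simp add: ac_simps)
    then show ?thesis by simp
  qed
  finally show ?thesis by (simp add: gen_binomial_of_nat)
next
  case False
  then have "nat n \<in> {0..<k}" "n - int (nat n) = 0" using assms by auto
  then have "(\<Prod>i = 0..<k. n - int i) = 0" by (metis finite_atLeastLessThan prod_zero)
  then have "gen_binomial n (int k) = 0" by (simp only: gen_binomial_of_nat div_0)
  then show ?thesis using False by simp
qed

text \<open>Upper negation: the factors of the falling factorial of \<open>-m\<close> are the
  negated factors of the rising factorial of \<open>m\<close>. For \<open>m = k = 0\<close> the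
  truncated \<open>m + k - 1\<close> is 0, which still gives the correct value 1.\<close>

lemma gen_binomial_neg:
  "gen_binomial (- int m) (int k) = (-1) ^ k * int ((m + k - 1) choose k)"
proof (cases m)
  case 0
  then show ?thesis using gen_binomial_nonneg[of 0 k] by (cases k) auto
next
  case (Suc m')
  have "(\<Prod>i = 0..<k. - int m - int i) = (\<Prod>i = 0..<k. (-1) * int (m + i))"
    by (intro prod.cong) auto
  also have "\<dots> = (-1) ^ k * int (\<Prod>i = 0..<k. m + i)"
    unfolding prod.distrib by simp
  also have "(\<Prod>i = 0..<k. m + i) = pochhammer m k"
    by (simp add: pochhammer_prod)
  also have "pochhammer m k = fact k * ((m + k - 1) choose k)"
  proof -
    have "pochhammer (Suc m') k * fact m' = fact (m' + k)"
      by (induction k) (auto simp: pochhammer_Suc algebra_simps)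
    moreover have "fact k * fact m' * ((m' + k) choose k) = fact (m' + k)"
      using binomial_fact_lemma[of k "m' + k"] by simp
    ultimately have "pochhammer (Suc m') k * fact m' = (fact k * ((m' + k) choose k)) * fact m'"
      by (simp add: ac_simps)
    then show ?thesis using Suc by simp
  qed
  finally show ?thesis
    by (simp add: gen_binomial_of_nat mult.left_commute)
qed

text \<open>Coefficientwise form of (1 + t)^(-m) = (1 + t) (1 + t)^(-m-1).\<close>

lemma gen_binomial_neg_Pascal:
  "gen_binomial (- int m) (int (Suc k)) =
     gen_binomial (- int (Suc m)) (int (Suc k)) + gen_binomial (- int (Suc m)) (int k)"
  unfolding gen_binomial_neg
  by (cases m; cases k) (auto simp: algebra_simps binomial_eq_0)

text \<open>As power series, p = (1 + t)^(-m) D, and the binomials are the coefficients of (1 +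
  t)^(-m). The induction on \<open>m\<close> divides by one factor at a time and stays within
  polynomials.\<close>

lemma coeff_quotient_one_plus_X_power:
  fixes p D :: "'a :: comm_ring_1 poly"
  assumes "D = [:1, 1:] ^ m * p"
  shows "coeff p s = (\<Sum>u\<le>s. of_int (gen_binomial (- int m) (int (s - u))) * coeff D u)"
  using assms
proof (induction m arbitrary: p s)
  case 0
  have "(\<Sum>u\<le>s. of_int (gen_binomial 0 (int (s - u))) * coeff D u) =
        (\<Sum>u\<le>s. if u = s then coeff D u else 0)"
    using gen_binomial_nonneg[of 0]
    by (intro sum.cong) (auto simp: binomial_eq_0 simp del: of_nat_diff)
  then show ?case using 0 by simp
next
  case (Suc m)
  define g where "g m k = (of_int (gen_binomial (- int m) (int k)) :: 'a)" for m k
  have IH: "coeff ([:1, 1:] * p) s = (\<Sum>u\<le>s. g m (s - u) * coeff D u)" for s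
    unfolding g_def by (rule Suc.IH) (use Suc.prems in \<open>unfold power_Suc2 mult.assoc\<close>)
  have g0: "g m 0 = 1" for m
    using gen_binomial_neg[of m 0] by (simp add: g_def)
  have P: "g m (Suc k) = g (Suc m) (Suc k) + g (Suc m) k" for k
    unfolding g_def by (simp only: gen_binomial_neg_Pascal[of m k] of_int_add)
  show ?case unfolding g_def[symmetric]
  proof (induction s)
    case 0
    show ?case using IH[of 0] by (simp add: g0)
  next
    case (Suc s)
    \<comment> \<open>The left side is the coefficient of \<open>t ^ Suc s\<close> in
      \<open>(1 + t) * p\<close>. Pascal's rule splits the right side into the desired sum and the
      sum for \<open>s\<close>; the latter is \<open>coeff p s\<close> by the inner induction and
      cancels.\<close>
    have "coeff p (Suc s) + coeff p s = (\<Sum>u\<le>Suc s. g m (Suc s - u) * coeff D u)"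
      using IH[of "Suc s"] by simp
    also have "\<dots> = coeff D (Suc s) + (\<Sum>u\<le>s. g m (Suc (s - u)) * coeff D u)"
      by (simp add: g0 Suc_diff_le)
    also have "\<dots> = coeff D (Suc s) + (\<Sum>u\<le>s. g (Suc m) (Suc (s - u)) * coeff D u) + coeff p s"
      unfolding P Suc by (simp add: algebra_simps sum.distrib)
    also have "coeff D (Suc s) + (\<Sum>u\<le>s. g (Suc m) (Suc (s - u)) * coeff D u) =
       (\<Sum>u\<le>Suc s. g (Suc m) (Suc s - u) * coeff D u)"
      by (simp add: g0 Suc_diff_le)
    finally show ?case by simp
  qed
qed

text \<open>The power of 1 + t is monic of degree \<open>m\<close>, so \<open>p\<close> has degree
  at most \<open>s\<close>, and only the product of the two top coefficients contributes.\<close>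

lemma coeff_one_plus_X_power_mult:
  fixes p :: "'a :: idom poly"
  assumes "degree ([:1, 1:] ^ m * p) \<le> m + s"
  shows "coeff ([:1, 1:] ^ m * p) (m + s) = coeff p s"
proof (cases "p = 0")
  case False
  have dm: "degree ([:1, 1:] ^ m :: 'a poly) = m" by (simp add: degree_power_eq)
  then have "degree ([:1, 1:] ^ m * p) = m + degree p"
    using False by (simp add: degree_mult_eq)
  then consider "degree p = s" | "degree p < s" using assms by linarith
  then show ?thesis
  proof cases
    case 1
    have "coeff ([:1, 1:] ^ m) m = (1 :: 'a)"
      using lead_coeff_power[of "[:1, 1 :: 'a:]" m] dm by simp
    then show ?thesis
      using coeff_mult_degree_sum[of "[:1, 1:] ^ m" p] dm 1 by simp
  next
    case 2
    then show ?thesis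
      using \<open>degree ([:1, 1:] ^ m * p) = m + degree p\<close> by (simp add: coeff_eq_0)
  qed
qed simp

subsection \<open>Determinants\<close>

lemma det_permute_cols:
  assumes A: "A \<in> carrier_mat n n" and p: "p permutes {0..<n}"
  shows "det (mat n n (\<lambda>(i, j). A $$ (i, p j))) = signof p * det A"
proof -
  have "mat n n (\<lambda>(i, j). A $$ (i, p j)) = (mat n n (\<lambda>(i, j). A\<^sup>T $$ (p i, j)))\<^sup>T"
    using A permutes_in_image[OF p] by (intro eq_matI) auto
  then show ?thesis
    using det_permute_rows[of "A\<^sup>T" n p] A p by (simp add: det_transpose[of _ n])
qed

text \<open>The set \<open>W\<close> contains one element of each 2-cycle, so \<open>p\<close> is a
  product of \<open>card W\<close> disjoint transpositions.\<close>

lemma sign_involution: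
  assumes "finite W" and "p \<circ> p = id" and "p ` W \<inter> W = {}" and "{x. p x \<noteq> x} = W \<union> p ` W"
  shows "sign p = (-1) ^ card W"
  using assms
proof (induction W arbitrary: p rule: finite_induct)
  case empty
  then have "p = id" by auto
  then show ?case by simp
next
  case (insert w W)
  have inv: "p (p x) = x" for x
    using insert.prems(1) by (metis comp_apply id_apply)
  then have inj: "p x = p y \<longleftrightarrow> x = y" for x y
    by metis
  have wp: "p w \<noteq> w" using insert.prems by auto
  \<comment> \<open>Undoing the 2-cycle of \<open>w\<close> leaves an involution whose 2-cycles are
    represented by \<open>W\<close>.\<close>
  define q where "q = transpose w (p w) \<circ> p"
  have qx: "q x = (if x = w \<or> x = p w then x else p x)" for x
    unfolding q_def using inv inj by (auto simp: transpose_def)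
  have pq: "p = transpose w (p w) \<circ> q"
    unfolding q_def by (simp add: fun_eq_iff)
  have qq: "q \<circ> q = id"
    using inv inj by (auto simp: fun_eq_iff qx)
  have W: "w \<notin> p ` W" "p w \<notin> W" "w \<notin> W" using insert by auto
  have qW: "q ` W = p ` W"
    using W by (intro image_cong) (auto simp: qx)
  have "p w \<notin> p ` W" using W inj by auto
  then have supp: "{x. q x \<noteq> x} = W \<union> p ` W"
    using insert.prems(3) W inv wp by (auto simp: qx set_eq_iff)
  have "sign q = (-1) ^ card W"
    using insert.prems(2) by (intro insert.IH qq) (auto simp: qW supp)
  moreover have "permutation q"
  proof -
    have "bij q" using qq o_bij by blast
    moreover have "finite {x. q x \<noteq> x}" unfolding supp using insert by simp
    ultimately show ?thesis by (simp add: permutation)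
  qed
  moreover have "permutation (transpose w (p w))"
    by (rule permutation_swap_id)
  ultimately have "sign p = - ((-1) ^ card W)"
    by (subst pq) (use wp in \<open>simp add: sign_compose sign_swap_id\<close>)
  then show ?case using insert.hyps by simp
qed

section \<open>Stacked matrices and generalised Laplace expansion\<close>

definition stack_mat ::
  "'a :: comm_ring_1 mat \<Rightarrow> nat \<Rightarrow> (nat \<Rightarrow> nat) \<Rightarrow> (nat \<Rightarrow> 'a) \<Rightarrow> (nat \<Rightarrow> 'a) \<Rightarrow> 'a mat" where
  "stack_mat M r c \<alpha> \<beta> = mat (2 * r) (2 * r)
     (\<lambda>(i, j). if i < r then \<alpha> j * M $$ (i, c j) else \<beta> j * M $$ (i - r, c j))"

text \<open>The pure case: column \<open>j\<close> keeps only its upper copy if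
  \<open>j \<in> T\<close>, and only its lower copy otherwise. If \<open>T\<close> consists of
  \<open>r\<close> of the columns, the determinant is, up to sign, the product of the two
  determinants formed by the columns in \<open>T\<close> and by the remaining ones.\<close>

abbreviation split_mat :: "'a :: comm_ring_1 mat \<Rightarrow> nat \<Rightarrow> (nat \<Rightarrow> nat) \<Rightarrow> nat set \<Rightarrow> 'a mat" where
  "split_mat M r c T \<equiv> stack_mat M r c (\<lambda>j. if j \<in> T then 1 else 0) (\<lambda>j. if j \<in> T then 0 else 1)"

lemma stack_mat_carrier [simp]: "stack_mat M r c \<alpha> \<beta> \<in> carrier_mat (2 * r) (2 * r)"
  by (simp add: stack_mat_def)

text \<open>Multilinearity: every column is the sum of an upper and a lower part, and
  \<open>T\<close> records the columns for which the upper part is chosen. Both sides are compared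
  through the Leibniz formula.\<close>

lemma det_stack_mat:
  "det (stack_mat M r c \<alpha> \<beta>) =
     (\<Sum>T\<in>Pow {..<2 * r}. prod \<alpha> T * prod \<beta> ({..<2 * r} - T) * det (split_mat M r c T))"
proof -
  let ?I = "{..<2 * r}" and ?P = "{p. p permutes {0..<2 * r}}"
  \<comment> \<open>The entry in row \<open>p j\<close> of column \<open>j\<close>, cut down to the
    upper half for \<open>u\<close> and to the lower half for \<open>l\<close>.\<close>
  define u l where "u p j = (if p j < r then M $$ (p j, c j) else 0)"
    and "l p j = (if p j < r then 0 else M $$ (p j - r, c j))" for p :: "nat \<Rightarrow> nat" and j
  have entry: "stack_mat M r c \<gamma> \<delta> $$ (p j, j) = \<gamma> j * u p j + \<delta> j * l p j"
    if "p \<in> ?P" "j \<in> ?I" for \<gamma> \<delta> p j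
    using that permutes_in_image[of p "{0..<2 * r}" j] by (auto simp: stack_mat_def u_def l_def)
  have split: "det (split_mat M r c T) =
      (\<Sum>p\<in>?P. signof p * (prod (u p) T * prod (l p) (?I - T)))" if "T \<subseteq> ?I" for T
  proof -
    have "(\<Prod>j\<in>?I. split_mat M r c T $$ (p j, j)) = prod (u p) T * prod (l p) (?I - T)"
      if "p \<in> ?P" for p
    proof -
      have "(\<Prod>j\<in>?I. split_mat M r c T $$ (p j, j)) = (\<Prod>j\<in>?I. if j \<in> T then u p j else l p j)"
        using entry[OF that] by (intro prod.cong) auto
      also have "\<dots> = prod (u p) T * prod (l p) (?I - T)"
        using \<open>T \<subseteq> ?I\<close> by (simp add: prod.If_cases Int_absorb1 Diff_eq)
      finally show ?thesis .
    qed
    then show ?thesis by (simp add: det_col[of _ "2 * r"])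
  qed
  have "det (stack_mat M r c \<alpha> \<beta>) =
      (\<Sum>p\<in>?P. signof p * (\<Prod>j\<in>?I. \<alpha> j * u p j + \<beta> j * l p j))"
    using entry by (simp add: det_col[of _ "2 * r"])
  also have "\<dots> = (\<Sum>p\<in>?P. \<Sum>T\<in>Pow ?I. prod \<alpha> T * prod \<beta> (?I - T) *
      (signof p * (prod (u p) T * prod (l p) (?I - T))))"
    by (simp add: prod_add prod.distrib sum_distrib_left mult_ac)
  also have "\<dots> = (\<Sum>T\<in>Pow ?I. \<Sum>p\<in>?P. prod \<alpha> T * prod \<beta> (?I - T) *
      (signof p * (prod (u p) T * prod (l p) (?I - T))))"
    by (rule sum.swap)
  also have "\<dots> = (\<Sum>T\<in>Pow ?I. prod \<alpha> T * prod \<beta> (?I - T) * det (split_mat M r c T))"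
    by (intro sum.cong) (auto simp: split sum_distrib_left)
  finally show ?thesis .
qed

text \<open>A nonzero Leibniz summand would have to match the columns in \<open>T\<close>
  bijectively with the \<open>r\<close> upper rows.\<close>

lemma det_split_mat_card_neq:
  assumes "T \<subseteq> {..<2 * r}" and "card T \<noteq> r"
  shows "det (split_mat M r c T) = 0"
proof -
  have "(\<Prod>j<2 * r. split_mat M r c T $$ (p j, j)) = 0" if p: "p permutes {0..<2 * r}" for p
  proof -
    have "\<exists>j<2 * r. \<not> (j \<in> T \<longleftrightarrow> p j < r)"
    proof (rule ccontr)
      assume "\<not> ?thesis"
      then have T: "T = {j. j < 2 * r \<and> p j < r}" using assms(1) by auto
      have "p ` T = {..<r}"
      proof
        show "{..<r} \<subseteq> p ` T"
        proof
          fix i assume "i \<in> {..<r}"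
          then have "i \<in> p ` {0..<2 * r}" using permutes_image[OF p] by auto
          then show "i \<in> p ` T" using T \<open>i \<in> {..<r}\<close> by auto
        qed
      qed (use T in auto)
      moreover have "card (p ` T) = card T"
        using permutes_inj[OF p] by (intro card_image) (auto simp: inj_on_def)
      ultimately show False using assms(2) by simp
    qed
    then obtain j where "j < 2 * r" "\<not> (j \<in> T \<longleftrightarrow> p j < r)" by blast
    moreover from this have "split_mat M r c T $$ (p j, j) = 0"
      using permutes_in_image[OF p, of j] by (auto simp: stack_mat_def)
    ultimately show ?thesis by (intro prod_zero) auto
  qed
  then show ?thesis by (simp add: det_col[of _ "2 * r"])
qed

lemma det_stack_mat_identical:
  assumes "i < 2 * r" "j < 2 * r" "i \<noteq> j" "c i = c j" "\<alpha> i = \<alpha> j" "\<beta> i = \<beta> j"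
  shows "det (stack_mat M r c \<alpha> \<beta>) = 0"
  using assms by (intro det_identical_columns[of _ "2 * r" i j]) (auto simp: stack_mat_def)

section \<open>Row operations\<close>

lemma row_scalar_prod_scaled_col:
  fixes M :: "'a :: comm_ring_1 mat"
  assumes "P \<in> carrier_mat r r" and "M \<in> carrier_mat r n" and "i < r" and "x < n"
  shows "row P i \<bullet> vec r (\<lambda>k. a * M $$ (k, x)) = a * (P * M) $$ (i, x)"
  using assms by (simp add: scalar_prod_def sum_distrib_left mult.left_commute)

text \<open>Left multiplication by this block matrix subtracts the upper half from the lower half
  and then multiplies the lower half by \<open>P\<close>.\<close>

lemma det_subtract_rows_mat:
  fixes P :: "'a :: idom mat"
  assumes "P \<in> carrier_mat r r"
  shows "det (four_block_mat (1\<^sub>m r) (0\<^sub>m r r) (- P) P) = det P"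
proof -
  have "det (four_block_mat (1\<^sub>m r) (0\<^sub>m r r) (- P) P) = det (1\<^sub>m r) * det P"
    by (rule det_four_block_mat_upper_right_zero) (use assms in auto)
  then show ?thesis by simp
qed

text \<open>Both halves of column \<open>j\<close> are multiples of the same column of
  \<open>M\<close>, so their difference carries the single factor
  \<open>\<beta> j - \<alpha> j\<close>.\<close>

lemma subtract_rows_mat_mult_stack_mat:
  fixes M :: "'a :: comm_ring_1 mat"
  assumes P: "P \<in> carrier_mat r r" and M: "M \<in> carrier_mat r n"
    and c: "\<And>j. j < 2 * r \<Longrightarrow> c j < n"
  shows "four_block_mat (1\<^sub>m r) (0\<^sub>m r r) (- P) P * stack_mat M r c \<alpha> \<beta> =
    mat (2 * r) (2 * r) (\<lambda>(i, j). if i < r then \<alpha> j * M $$ (i, c j)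
      else (\<beta> j - \<alpha> j) * (P * M) $$ (i - r, c j))"
proof -
  let ?N11 = "mat r r (\<lambda>(i, j). \<alpha> j * M $$ (i, c j))"
  let ?N12 = "mat r r (\<lambda>(i, j). \<alpha> (r + j) * M $$ (i, c (r + j)))"
  let ?N21 = "mat r r (\<lambda>(i, j). \<beta> j * M $$ (i, c j))"
  let ?N22 = "mat r r (\<lambda>(i, j). \<beta> (r + j) * M $$ (i, c (r + j)))"
  have "stack_mat M r c \<alpha> \<beta> = four_block_mat ?N11 ?N12 ?N21 ?N22"
    by (intro eq_matI) (auto simp: stack_mat_def)
  then have "four_block_mat (1\<^sub>m r) (0\<^sub>m r r) (- P) P * stack_mat M r c \<alpha> \<beta> =
      four_block_mat ?N11 ?N12 (- P * ?N11 + P * ?N21) (- P * ?N12 + P * ?N22)"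
    using P by (simp add: mult_four_block_mat[of _ r r _ r _ r _ _ r _ r])
  then show ?thesis
    using P c row_scalar_prod_scaled_col[OF P M]
    by (intro eq_matI) (auto simp: left_diff_distrib)
qed

text \<open>Gauss-Jordan elimination is applied to a matrix \<open>L\<close> whose columns form a
  basis of the column space of \<open>K\<close>. Since \<open>L\<close> has only
  \<open>rank K\<close> columns, all later rows of \<open>P * L\<close> vanish, and every column of
  \<open>K\<close> is a combination of columns of \<open>L\<close>.\<close>

lemma exists_invertible_rank_rows_zero:
  fixes K :: "'a :: field mat"
  assumes K: "K \<in> carrier_mat r m"
  shows "\<exists>P \<in> carrier_mat r r. det P \<noteq> 0 \<and>
    (\<forall>i j. vec_space.rank r K \<le> i \<longrightarrow> i < r \<longrightarrow> j < m \<longrightarrow> (P * K) $$ (i, j) = 0)"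
proof -
  interpret vec_space "TYPE('a)" r .
  have cK: "set (cols K) \<subseteq> carrier_vec r" using cols_dim K by blast
  obtain S where S: "maximal S (\<lambda>T. T \<subseteq> set (cols K) \<and> lin_indpt T)"
    using maximal_exists[of "(\<lambda>T. T \<subseteq> set (cols K) \<and> lin_indpt T)" "card (set (cols K))" "{}"]
    by (meson List.finite_set card_mono empty_iff empty_subsetI finite_lin_indpt2 rev_finite_subset)
  then have SK: "S \<subseteq> set (cols K)" and li: "lin_indpt S" by (auto simp: maximal_def)
  have "finite S" using SK finite_subset by blast
  then obtain ss where ss: "set ss = S" "distinct ss"
    using finite_distinct_list by blast
  have cS: "S \<subseteq> carrier_vec r" using SK cK by blast
  have len: "length ss = rank K"
    using rank_card_indpt[OF K S] ss distinct_card by fastforce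
  define L where "L = mat_of_cols r ss"
  have L: "L \<in> carrier_mat r (rank K)" by (simp add: L_def len[symmetric])
  have span: "\<exists>v. dim_vec v = rank K \<and> w = L *\<^sub>v v" if w: "w \<in> set (cols K)" for w
  proof -
    have "w \<in> span S"
    proof (rule ccontr)
      assume n: "w \<notin> span S"
      then have "w \<notin> S" using span_mem cS by blast
      have "lin_indpt (S \<union> {w})"
        using lin_dep_iff_in_span[OF cS li _ \<open>w \<notin> S\<close>] w cK n by blast
      then show False using S w SK \<open>w \<notin> S\<close> unfolding maximal_def by blast
    qed
    then have "w \<in> span_list ss" using span_list_as_span[of ss] ss cS by simp
    then obtain f where "w = lincomb_list f ss" by (rule in_span_listE)
    also have "\<dots> = L *\<^sub>v vec (length ss) f"
      unfolding L_def by (rule lincomb_list_as_mat_mult) (use cS ss in auto)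
    finally show ?thesis using len by (intro exI[of _ "vec (rank K) f"]) simp
  qed
  \<comment> \<open>The companion matrix has no columns, as only the transformation \<open>P\<close>
    of \<open>L\<close> is of interest.\<close>
  obtain C D where CD: "gauss_jordan L (0\<^sub>m r 0) = (C, D)" by fastforce
  obtain P where "P \<in> Units (ring_mat TYPE('a) r ())" and C: "C = P * L"
    using gauss_jordan_transform[OF L zero_carrier_mat CD, of "()"] by blast
  then have P: "P \<in> carrier_mat r r" "det P \<noteq> 0"
    using unit_imp_det_non_zero by (auto simp: Units_def ring_mat_def)
  have Cc: "C \<in> carrier_mat r (rank K)" using C P L by simp
  from gauss_jordan_row_echelon[OF L CD] obtain f where f: "pivot_fun C f (rank K)"
    using Cc by (auto simp: row_echelon_form_def)
  \<comment> \<open>Pivot columns strictly increase, so a pivot of row \<open>i\<close> lies in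
    column \<open>i\<close> or later. From row \<open>rank K\<close> on there is no such column, and
    the value \<open>rank K\<close> of the pivot function marks a zero row.\<close>
  have row0: "row C i = 0\<^sub>v (rank K)" if "i < r" "rank K \<le> i" for i
  proof -
    have "f i = rank K"
      using pivot_bound[OF _ f, of r 0 i] pivot_funD(1)[OF _ f, of r i] Cc that by auto
    then show ?thesis using pivot_fun_zero_row_iff[OF f Cc] that by simp
  qed
  have "(P * K) $$ (i, j) = 0" if i: "rank K \<le> i" "i < r" and j: "j < m" for i j
  proof -
    have "col K j \<in> set (cols K)" using j K by (simp add: cols_def)
    then obtain v where v: "dim_vec v = rank K" "col K j = L *\<^sub>v v" using span by blast
    have "(P * K) $$ (i, j) = (P *\<^sub>v (L *\<^sub>v v)) $ i"
      using i j P K v by simp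
    also have "P *\<^sub>v (L *\<^sub>v v) = C *\<^sub>v v"
      using P L v C by (metis assoc_mult_mat_vec carrier_vec_dim_vec)
    also have "(C *\<^sub>v v) $ i = row C i \<bullet> v" using i Cc by simp
    also have "\<dots> = 0" using row0 i v by (metis carrier_vec_dim_vec scalar_prod_left_zero)
    finally show ?thesis .
  qed
  then show ?thesis using P by blast
qed

subsection \<open>Positions and labels of columns\<close>

lemma permutes_inverseI:
  assumes "\<And>x. q (p x) = x" "\<And>x. p (q x) = x" "\<And>x. x \<notin> S \<Longrightarrow> p x = x"
  shows "p permutes S"
  unfolding permutes_def using assms by metis

lemma Plus_Diff_vimage:
  assumes "S \<subseteq> A <+> B"
  shows "(A - (A - Inl -` S)) <+> (Inr -` S) = S"
proof (rule Set.set_eqI)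
  fix z show "z \<in> (A - (A - Inl -` S)) <+> (Inr -` S) \<longleftrightarrow> z \<in> S"
    using assms by (cases z) auto
qed

text \<open>An element and its image have the same position in \<open>U\<close> and \<open>V\<close>
  respectively, so exchanging back restores the element.\<close>

lemma exchange_index_mem:
  assumes "finite U" "card U = card V" "x \<in> U"
  shows "exchange_index U V x \<in> V"
    and "exchange_index V U (exchange_index U V x) = x"
proof -
  have lt: "card {a \<in> U. a < x} < card U"
    using assms by (intro psubset_card_mono) auto
  then show V: "exchange_index U V x \<in> V"
    using assms by (simp add: exchange_index_def pick_in_set_le)
  show "exchange_index V U (exchange_index U V x) = x"
    using V lt assms by (simp add: exchange_index_def card_pick_le pick_card_in_set)
qed

text \<open>Together with \<open>label\<close>, this numbers the disjoint union
  \<open>A <+> B\<close> by the columns \<open>0, ..., 2 * r - 1\<close>: first \<open>A\<close>,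
  then \<open>B\<close>, each in increasing order. The disjoint union keeps apart the two
  occurrences of an element of \<open>A \<inter> B\<close>.\<close>

definition place :: "nat \<Rightarrow> nat set \<Rightarrow> nat set \<Rightarrow> nat + nat \<Rightarrow> nat" where
  "place r A B = case_sum (\<lambda>x. card {a \<in> A. a < x}) (\<lambda>y. r + card {b \<in> B. b < y})"

definition label :: "nat \<Rightarrow> nat set \<Rightarrow> nat set \<Rightarrow> nat \<Rightarrow> nat + nat" where
  "label r A B j = (if j < r then Inl (pick A j) else Inr (pick B (j - r)))"

abbreviation label_col :: "nat \<Rightarrow> nat set \<Rightarrow> nat set \<Rightarrow> nat \<Rightarrow> nat" where
  "label_col r A B j \<equiv> case_sum id id (label r A B j)"

context
  fixes r :: nat and A B :: "nat set"
  assumes fin: "finite A" "finite B" and card: "card A = r" "card B = r"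
begin

lemma label_mem: "j < 2 * r \<Longrightarrow> label r A B j \<in> A <+> B"
  using card by (auto simp: label_def pick_in_set_le)

lemma place_label: "j < 2 * r \<Longrightarrow> place r A B (label r A B j) = j"
  using card by (auto simp: label_def place_def card_pick_le)

lemma place_less_left: "x \<in> A \<Longrightarrow> place r A B (Inl x) < r"
  unfolding place_def card(1)[symmetric] using fin by (auto intro!: psubset_card_mono)

lemma place_less: "z \<in> A <+> B \<Longrightarrow> place r A B z < 2 * r"
proof (elim PlusE)
  fix y assume "y \<in> B" and z: "z = Inr y"
  then have "card {b \<in> B. b < y} < card B"
    using fin by (intro psubset_card_mono) auto
  then show ?thesis using z card by (simp add: place_def)
qed (use place_less_left in fastforce)

lemma label_place: "z \<in> A <+> B \<Longrightarrow> label r A B (place r A B z) = z"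
proof (elim PlusE)
  fix x assume "x \<in> A" "z = Inl x"
  then show ?thesis
    using place_less_left[of x] by (simp add: label_def place_def pick_card_in_set)
qed (auto simp: label_def place_def pick_card_in_set)

lemma inj_on_place: "inj_on (place r A B) (A <+> B)"
  by (metis inj_on_inverseI label_place)

lemma place_image_eq:
  assumes "S \<subseteq> A <+> B"
  shows "place r A B ` S = {j. j < 2 * r \<and> label r A B j \<in> S}"
proof (intro equalityI subsetI)
  fix j assume "j \<in> {j. j < 2 * r \<and> label r A B j \<in> S}"
  then show "j \<in> place r A B ` S"
    using place_label[of j] by (intro image_eqI[of j _ "label r A B j"]) simp_all
next
  fix j assume "j \<in> place r A B ` S"
  then obtain z where z: "z \<in> S" "j = place r A B z" by blast
  then have "z \<in> A <+> B" using assms by blast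
  then show "j \<in> {j. j < 2 * r \<and> label r A B j \<in> S}"
    using z label_place place_less by simp
qed

lemma place_image_Diff:
  "S \<subseteq> A <+> B \<Longrightarrow> {..<2 * r} - place r A B ` S = place r A B ` ((A <+> B) - S)"
  using label_mem by (auto simp: place_image_eq)

lemma prod_place_image:
  assumes "S \<subseteq> A <+> B"
  shows "(\<Prod>j\<in>place r A B ` S. f (label r A B j)) = prod f S"
proof -
  have "label r A B (place r A B z) = z" if "z \<in> S" for z
    using assms label_place that by blast
  then show ?thesis
    using inj_on_subset[OF inj_on_place assms] by (subst prod.reindex) (auto intro!: prod.cong)
qed

text \<open>The expansion over \<open>T\<close>, reindexed by exchanges: initially \<open>A\<close>
  is above and \<open>B\<close> below; \<open>U\<close> is the part of \<open>A\<close> that moves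
  down and \<open>V\<close> the part of \<open>B\<close> that moves up.\<close>

lemma det_stack_mat_label:
  "det (stack_mat M r (label_col r A B) (\<lambda>j. f (label r A B j)) (\<lambda>j. g (label r A B j))) =
    (\<Sum>(U, V)\<in>Pow A \<times> Pow B.
       (\<Prod>x\<in>A - U. f (Inl x)) * (\<Prod>y\<in>V. f (Inr y)) * ((\<Prod>x\<in>U. g (Inl x)) * (\<Prod>y\<in>B - V. g (Inr y))) *
       det (split_mat M r (label_col r A B) (place r A B ` ((A - U) <+> V))))"
proof -
  let ?I = "{..<2 * r}" and ?l = "label r A B" and ?p = "place r A B"
  let ?F = "\<lambda>T. (\<Prod>j\<in>T. f (?l j)) * (\<Prod>j\<in>?I - T. g (?l j)) * det (split_mat M r (label_col r A B) T)"
  have "det (stack_mat M r (label_col r A B) (\<lambda>j. f (?l j)) (\<lambda>j. g (?l j))) = sum ?F (Pow ?I)"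
    by (rule det_stack_mat)
  also have "\<dots> = (\<Sum>(U, V)\<in>Pow A \<times> Pow B. ?F (?p ` ((A - U) <+> V)))"
  proof (rule sum.reindex_bij_witness[of _ "\<lambda>(U, V). ?p ` ((A - U) <+> V)"
        "\<lambda>T. (A - Inl -` ?l ` T, Inr -` ?l ` T)"])
    fix T assume "T \<in> Pow ?I"
    then have T: "T \<subseteq> ?I" by simp
    then have lT: "?l ` T \<subseteq> A <+> B" using label_mem by auto
    have "?p ` ?l ` T = (\<lambda>j. j) ` T"
      unfolding image_image by (rule image_cong) (use T place_label in auto)
    then have T': "?p ` ((A - (A - Inl -` ?l ` T)) <+> (Inr -` ?l ` T)) = T"
      by (simp only: Plus_Diff_vimage[OF lT] image_ident)
    then show "(\<lambda>(U, V). ?p ` ((A - U) <+> V)) (A - Inl -` ?l ` T, Inr -` ?l ` T) = T"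
      by simp
    show "(A - Inl -` ?l ` T, Inr -` ?l ` T) \<in> Pow A \<times> Pow B"
      using lT by auto
    show "(case (A - Inl -` ?l ` T, Inr -` ?l ` T) of (U, V) \<Rightarrow> ?F (?p ` ((A - U) <+> V))) = ?F T"
      by (simp only: prod.case T')
  next
    fix b assume "b \<in> Pow A \<times> Pow B"
    then obtain U V where b: "b = (U, V)" "U \<subseteq> A" "V \<subseteq> B" by auto
    then have S: "(A - U) <+> V \<subseteq> A <+> B" by auto
    have "?l ` ?p ` ((A - U) <+> V) = (\<lambda>z. z) ` ((A - U) <+> V)"
      unfolding image_image by (rule image_cong) (use S label_place in auto)
    then have "?l ` ?p ` ((A - U) <+> V) = (A - U) <+> V" by (simp only: image_ident)
    moreover have "A - Inl -` ((A - U) <+> V) = U" "Inr -` ((A - U) <+> V) = V"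
      using b by auto
    ultimately show "(A - Inl -` ?l ` (case b of (U, V) \<Rightarrow> ?p ` ((A - U) <+> V)),
        Inr -` ?l ` (case b of (U, V) \<Rightarrow> ?p ` ((A - U) <+> V))) = b"
      by (simp only: b prod.case)
    show "(case b of (U, V) \<Rightarrow> ?p ` ((A - U) <+> V)) \<in> Pow ?I"
      using S place_less by (auto simp: b)
  qed
  also have "\<dots> = (\<Sum>(U, V)\<in>Pow A \<times> Pow B.
       (\<Prod>x\<in>A - U. f (Inl x)) * (\<Prod>y\<in>V. f (Inr y)) * ((\<Prod>x\<in>U. g (Inl x)) * (\<Prod>y\<in>B - V. g (Inr y))) *
       det (split_mat M r (label_col r A B) (?p ` ((A - U) <+> V))))"
  proof (intro sum.cong refl, clarify)
    fix U V assume U: "U \<subseteq> A" and V: "V \<subseteq> B"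
    have D: "A <+> B - ((A - U) <+> V) = U <+> (B - V)"
      using U V by auto
    have S: "(A - U) <+> V \<subseteq> A <+> B" "U <+> (B - V) \<subseteq> A <+> B"
      using U V by auto
    have "finite U" "finite V" using U V fin finite_subset by auto
    then show "?F (?p ` ((A - U) <+> V)) =
       (\<Prod>x\<in>A - U. f (Inl x)) * (\<Prod>y\<in>V. f (Inr y)) * ((\<Prod>x\<in>U. g (Inl x)) * (\<Prod>y\<in>B - V. g (Inr y))) *
       det (split_mat M r (label_col r A B) (?p ` ((A - U) <+> V)))"
      using fin unfolding place_image_Diff[OF S(1)] D prod_place_image[OF S(1)] prod_place_image[OF S(2)]
      by (simp add: prod.Plus)
  qed
  finally show ?thesis .
qed

text \<open>Swapping each column of \<open>U\<close> with its partner in \<open>V\<close> makes the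
  matrix block diagonal, the blocks being M[A; -U, +V] and M[B; +U, -V]. This swap is a product of
  \<open>card U\<close> disjoint transpositions, whence the sign.\<close>

lemma det_split_mat_exchange:
  fixes M :: "'a :: idom mat"
  assumes M: "M \<in> carrier_mat r n" and U: "U \<subseteq> A" and V: "V \<subseteq> B" and UV: "card U = card V"
  shows "det (split_mat M r (label_col r A B) (place r A B ` ((A - U) <+> V))) =
           (-1) ^ card U * exchange_prod M A B U V"
proof -
  let ?l = "label r A B" and ?p = "place r A B"
  let ?T = "?p ` ((A - U) <+> V)"
  let ?N = "split_mat M r (label_col r A B) ?T"
  have finUV: "finite U" "finite V" using U V fin finite_subset by auto
  note e = exchange_index_mem[OF finUV(1) UV] exchange_index_mem[OF finUV(2) UV[symmetric]]
  \<comment> \<open>The swap is first described on labels and then transported to column positions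
    as \<open>\<pi>\<close>.\<close>
  define \<sigma> where "\<sigma> z = (case z of
      Inl x \<Rightarrow> if x \<in> U then Inr (exchange_index U V x) else Inl x
    | Inr y \<Rightarrow> if y \<in> V then Inl (exchange_index V U y) else Inr y)" for z
  have \<sigma>\<sigma>: "\<sigma> (\<sigma> z) = z" for z
    using e by (auto simp: \<sigma>_def split: sum.splits)
  have \<sigma>_mem: "\<sigma> z \<in> A <+> B" if "z \<in> A <+> B" for z
    using that e(1)[THEN subsetD[OF V]] e(3)[THEN subsetD[OF U]] by (auto simp: \<sigma>_def)
  define \<pi> where "\<pi> j = (if j < 2 * r then ?p (\<sigma> (?l j)) else j)" for j
  have \<pi>_less: "\<pi> j < 2 * r" and l\<pi>: "?l (\<pi> j) = \<sigma> (?l j)" if "j < 2 * r" for j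
    using that label_mem \<sigma>_mem place_less label_place by (auto simp: \<pi>_def)
  have \<pi>\<pi>: "\<pi> (\<pi> j) = j" for j
    using \<pi>_less[of j] l\<pi>[of j] \<sigma>\<sigma> place_label by (auto simp: \<pi>_def)
  then have "\<pi> \<circ> \<pi> = id" by auto
  then have perm: "\<pi> permutes {0..<2 * r}"
  proof (intro permutes_inverseI[where p = \<pi> and q = \<pi>])
    fix j assume "j \<notin> {0..<2 * r}"
    then show "\<pi> j = j" by (simp add: \<pi>_def)
  qed (use \<pi>\<pi> in simp_all)
  have \<pi>p: "\<pi> (?p z) = ?p (\<sigma> z)" if "z \<in> A <+> B" for z
    using that place_less label_place by (simp add: \<pi>_def)
  let ?W = "?p ` Inl ` U"
  have "Inl ` U \<subseteq> A <+> B" using U by auto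
  then have \<pi>W: "\<pi> ` ?W = ?p ` \<sigma> ` Inl ` U"
    unfolding image_image using \<pi>p by (intro image_cong) auto
  have \<sigma>U: "\<sigma> ` Inl ` U = Inr ` V"
  proof
    show "Inr ` V \<subseteq> \<sigma> ` Inl ` U"
    proof clarify
      fix y assume "y \<in> V"
      then have "exchange_index V U y \<in> U" "\<sigma> (Inl (exchange_index V U y)) = Inr y"
        using e by (auto simp: \<sigma>_def)
      then show "Inr y \<in> \<sigma> ` Inl ` U" by (metis imageI)
    qed
  qed (use e in \<open>auto simp: \<sigma>_def\<close>)
  have "sign \<pi> = (-1) ^ card ?W"
  proof (rule sign_involution)
    show "\<pi> ` ?W \<inter> ?W = {}"
      unfolding \<pi>W \<sigma>U using inj_on_place U V by (auto simp: inj_on_def)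
    have "{j. \<pi> j \<noteq> j} = {j. j < 2 * r \<and> ?l j \<in> Inl ` U \<union> Inr ` V}"
    proof (intro Collect_cong)
      fix j
      have "?p (\<sigma> (?l j)) \<noteq> j \<longleftrightarrow> \<sigma> (?l j) \<noteq> ?l j" if "j < 2 * r"
        using that place_label label_place label_mem \<sigma>_mem by metis
      moreover have "\<sigma> z \<noteq> z \<longleftrightarrow> z \<in> Inl ` U \<union> Inr ` V" for z
        by (cases z) (auto simp: \<sigma>_def)
      ultimately show "\<pi> j \<noteq> j \<longleftrightarrow> j < 2 * r \<and> ?l j \<in> Inl ` U \<union> Inr ` V"
        by (auto simp: \<pi>_def)
    qed
    also have "\<dots> = ?p ` (Inl ` U \<union> Inr ` V)"
      using U V by (subst place_image_eq) auto
    finally show "{j. \<pi> j \<noteq> j} = ?W \<union> \<pi> ` ?W"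
      by (simp add: \<pi>W \<sigma>U image_Un)
  qed (use finUV \<open>\<pi> \<circ> \<pi> = id\<close> in auto)
  moreover have "card ?W = card U"
    using U inj_on_subset[OF inj_on_place \<open>Inl ` U \<subseteq> A <+> B\<close>] by (simp add: card_image)
  ultimately have sign: "sign \<pi> = (-1) ^ card U" by simp
  \<comment> \<open>After the swap, the first \<open>r\<close> columns are exactly those that live
    in the upper half.\<close>
  have T: "\<pi> j \<in> ?T \<longleftrightarrow> j < r" and col: "label_col r A B (\<pi> j) =
      (if j < r then exchange_index U V (pick A j) else exchange_index V U (pick B (j - r)))"
    if j: "j < 2 * r" for j
  proof -
    have "\<pi> j \<in> ?T \<longleftrightarrow> \<sigma> (?l j) \<in> (A - U) <+> V"
      using U V \<pi>_less[OF j] l\<pi>[OF j] by (subst place_image_eq) auto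
    also have "\<dots> \<longleftrightarrow> j < r"
      using label_mem[OF j] e by (auto simp: \<sigma>_def label_def)
    finally show "\<pi> j \<in> ?T \<longleftrightarrow> j < r" .
    show "label_col r A B (\<pi> j) =
      (if j < r then exchange_index U V (pick A j) else exchange_index V U (pick B (j - r)))"
      unfolding l\<pi>[OF j] by (auto simp: \<sigma>_def label_def exchange_index_def)
  qed
  have "mat (2 * r) (2 * r) (\<lambda>(i, j). ?N $$ (i, \<pi> j)) =
      four_block_mat (col_exchange M A U V) (0\<^sub>m r r) (0\<^sub>m r r) (col_exchange M B V U)"
    using M card T col \<pi>_less
    by (intro eq_matI) (auto simp: stack_mat_def col_exchange_def)
  moreover have "det (four_block_mat (col_exchange M A U V) (0\<^sub>m r r) (0\<^sub>m r r) (col_exchange M B V U)) =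
      exchange_prod M A B U V"
    unfolding exchange_prod_def using M card
    by (intro det_four_block_mat_lower_left_zero[of _ r _ r]) (auto simp: col_exchange_def)
  ultimately have "exchange_prod M A B U V = (-1) ^ card U * det ?N"
    using det_permute_cols[OF _ perm, of ?N] sign by simp
  then show ?thesis by (simp add: mult.assoc[symmetric] power_mult_distrib[symmetric])
qed

text \<open>The complete exchange turns M[A] into a rearrangement of the columns of M[B] and vice
  versa. The two rearrangements are inverse to each other, so their signs cancel.\<close>

lemma exchange_prod_swap_all:
  fixes M :: "'a :: comm_ring_1 mat"
  assumes M: "M \<in> carrier_mat r n"
  shows "exchange_prod M A B (A - B) (B - A) = exchange_prod M A B {} {}"
proof -
  let ?e = "exchange_index (A - B) (B - A)" and ?e' = "exchange_index (B - A) (A - B)"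
  have "card (A - B) = card (B - A)"
    using card fin by (metis card_le_sym_Diff dual_order.antisym order_refl)
  note e = exchange_index_mem[OF _ this] exchange_index_mem[OF _ this[symmetric]]
  have e_fix: "x \<notin> A - B \<Longrightarrow> ?e x = x" "x \<notin> B - A \<Longrightarrow> ?e' x = x" for x
    by (simp_all only: exchange_index_def if_False)
  have eA: "?e x \<in> B" "?e' (?e x) = x" if "x \<in> A" for x
    using e[of x] e_fix[of x] fin that by (cases "x \<in> A - B"; force)+
  have eB: "?e' x \<in> A" "?e (?e' x) = x" if "x \<in> B" for x
    using e[of x] e_fix[of x] fin that by (cases "x \<in> B - A"; force)+
  let ?pos = "\<lambda>S x. card {a \<in> S. a < x}"
  have pos: "?pos A x < r" if "x \<in> A" for x
    unfolding card(1)[symmetric] using fin that by (auto intro!: psubset_card_mono)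
  have pos': "?pos B x < r" if "x \<in> B" for x
    unfolding card(2)[symmetric] using fin that by (auto intro!: psubset_card_mono)
  \<comment> \<open>\<open>p\<close> sends a position in \<open>A\<close> to the position in
    \<open>B\<close> of the element that replaces the one there; \<open>q\<close> does the same from
    \<open>B\<close> to \<open>A\<close>.\<close>
  define p where "p j = (if j < r then ?pos B (?e (pick A j)) else j)" for j
  define q where "q j = (if j < r then ?pos A (?e' (pick B j)) else j)" for j
  have pickA: "pick A j \<in> A" and pickB: "pick B j \<in> B" if "j < r" for j
    using that card pick_in_set_le by auto
  have pick_p: "pick B (p j) = ?e (pick A j)" and pick_q: "pick A (q j) = ?e' (pick B j)"
    and lt: "p j < r" "q j < r" if "j < r" for j
    using that eA[OF pickA] eB[OF pickB] pos pos' by (auto simp: p_def q_def pick_card_in_set)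
  have qp: "q (p j) = j" for j
  proof (cases "j < r")
    case True
    then show ?thesis
      using lt(1)[of j] pick_p[of j] eA(2)[OF pickA, of j] card by (simp add: q_def card_pick_le)
  qed (simp add: p_def q_def)
  have pq: "p (q j) = j" for j
  proof (cases "j < r")
    case True
    then show ?thesis
      using lt(2)[of j] pick_q[of j] eB(2)[OF pickB, of j] card by (simp add: p_def card_pick_le)
  qed (simp add: p_def q_def)
  have p: "p permutes {0..<r}"
  proof (intro permutes_inverseI[where p = p and q = q])
    fix j assume "j \<notin> {0..<r}"
    then show "p j = j" by (simp add: p_def)
  qed (simp_all add: qp pq)
  have q: "q permutes {0..<r}"
  proof (intro permutes_inverseI[where p = q and q = p])
    fix j assume "j \<notin> {0..<r}"
    then show "q j = j" by (simp add: q_def)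
  qed (simp_all add: qp pq)
  have A: "col_exchange M A (A - B) (B - A) = mat r r (\<lambda>(i, j). col_exchange M B {} {} $$ (i, p j))"
    using M card lt pick_p by (intro eq_matI) (auto simp: col_exchange_def exchange_index_def[of "{}"])
  have B: "col_exchange M B (B - A) (A - B) = mat r r (\<lambda>(i, j). col_exchange M A {} {} $$ (i, q j))"
    using M card lt pick_q by (intro eq_matI) (auto simp: col_exchange_def exchange_index_def[of "{}"])
  have "signof p * signof q = (1 :: 'a)"
  proof -
    have "sign p * sign q = 1"
      using sign_compose[of p q] p q pq permutation_permutes[of p] permutation_permutes[of q]
      by (auto simp: comp_def)
    then show ?thesis by (metis of_int_1 of_int_mult)
  qed
  moreover have C: "col_exchange M A {} {} \<in> carrier_mat r r" "col_exchange M B {} {} \<in> carrier_mat r r"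
    using M card by (auto simp: col_exchange_def)
  have "exchange_prod M A B (A - B) (B - A) =
      (signof p * signof q) * exchange_prod M A B {} {}"
    unfolding exchange_prod_def A B det_permute_cols[OF C(1) q] det_permute_cols[OF C(2) p]
    by (simp only: mult_ac)
  ultimately show ?thesis by simp
qed

end

subsection \<open>The generating polynomial of the exchange sums\<close>

text \<open>Determinants commute with the embedding of constants. The hypotheses keep all exchanged
  indices below \<open>n\<close>, where \<open>map_mat\<close> acts entrywise.\<close>

lemma exchange_prod_coeff_lift:
  fixes M :: "'a :: idom mat"
  assumes M: "M \<in> carrier_mat r n" and A: "A \<subseteq> {..<n}" and B: "B \<subseteq> {..<n}"
    and U: "U \<subseteq> A" and V: "V \<subseteq> B" and UV: "card U = card V"
    and card: "card A = r" "card B = r"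
  shows "exchange_prod (map_mat coeff_lift M) A B U V = [:exchange_prod M A B U V:]"
proof -
  have fin: "finite U" "finite V"
    using A B U V finite_subset[of _ "{..<n}"] by auto
  have index: "exchange_index U V (pick A j) < n" "exchange_index V U (pick B j) < n" if "j < r" for j
  proof -
    have "pick A j \<in> {..<n}" "pick B j \<in> {..<n}"
      using subsetD[OF A pick_in_set_le] subsetD[OF B pick_in_set_le] that card by auto
    moreover have "exchange_index U V x \<in> {..<n}" if "x \<in> {..<n}" for x
      using that exchange_index_mem(1)[OF fin(1) UV, of x] V B
      by (cases "x \<in> U") (auto simp: exchange_index_def)
    moreover have "exchange_index V U x \<in> {..<n}" if "x \<in> {..<n}" for x
      using that exchange_index_mem(1)[OF fin(2) UV[symmetric], of x] U A
      by (cases "x \<in> V") (auto simp: exchange_index_def)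
    ultimately show "exchange_index U V (pick A j) < n" "exchange_index V U (pick B j) < n"
      by auto
  qed
  have "col_exchange (map_mat coeff_lift M) A U V = map_mat coeff_lift (col_exchange M A U V)"
    "col_exchange (map_mat coeff_lift M) B V U = map_mat coeff_lift (col_exchange M B V U)"
    using M card index by (auto intro!: eq_matI simp: col_exchange_def)
  then show ?thesis
    by (simp add: exchange_prod_def)
qed

definition exchange_pairs :: "nat set \<Rightarrow> nat set \<Rightarrow> nat set \<Rightarrow> nat set \<Rightarrow> nat \<Rightarrow> (nat set \<times> nat set) set" where
  "exchange_pairs A B X Y u = {(U, V). U \<subseteq> A - B \<and> card U = u \<and> X \<subseteq> U \<and>
                          V \<subseteq> B - A \<and> card V = u \<and> Y \<subseteq> V}"

text \<open>
  The upper and lower coefficients of the columns of the \<open>2r \<times> 2r\<close> matrix with determinant \<open>D(t)\<close>.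
  A column indexed by \<open>A \<inter> B\<close> occurs once for \<open>A\<close>, with weights \<open>(1, 1)\<close>, and once for \<open>B\<close>,
  with weights \<open>(0, 1)\<close>. The lower weight \<open>1\<close> of the first occurrence does not change the
  determinant, but makes this column vanish when the upper rows are subtracted from the lower
  ones.
\<close>

definition top_weight :: "nat set \<Rightarrow> nat set \<Rightarrow> nat + nat \<Rightarrow> 'a :: comm_ring_1 poly" where
  "top_weight A X = case_sum (\<lambda>x. if x \<in> X then 0 else 1) (\<lambda>y. if y \<in> A then 0 else 1)"

definition bottom_weight :: "nat set \<Rightarrow> nat set \<Rightarrow> nat + nat \<Rightarrow> 'a :: comm_ring_1 poly" where
  "bottom_weight B Y = case_sum (\<lambda>x. if x \<in> B then 1 else - [:0, 1:]) (\<lambda>y. if y \<in> Y then 0 else 1)"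

definition exchange_poly ::
  "'a :: comm_ring_1 mat \<Rightarrow> nat \<Rightarrow> nat set \<Rightarrow> nat set \<Rightarrow> nat set \<Rightarrow> nat set \<Rightarrow> 'a poly" where
  "exchange_poly M r A B X Y = det (stack_mat (map_mat coeff_lift M) r (label_col r A B)
     (\<lambda>j. top_weight A X (label r A B j)) (\<lambda>j. bottom_weight B Y (label r A B j)))"

context
  fixes M :: "'a :: field mat" and r n :: nat and A B X Y :: "nat set"
  assumes M: "M \<in> carrier_mat r n"
    and A: "A \<subseteq> {..<n}" and B: "B \<subseteq> {..<n}"
    and card: "card A = r" "card B = r"
    and X: "X \<subseteq> A - B" and Y: "Y \<subseteq> B - A"
begin

lemma finite_AB: "finite A" "finite B"
  using A B finite_subset by auto

text \<open>Zero weights remove every pair with \<open>X\<close> not inside \<open>U\<close>, with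
  \<open>Y\<close> not inside \<open>V\<close>, or with \<open>V\<close> meeting \<open>A\<close>.
  The remaining unwanted pairs have a vanishing determinant: either \<open>U\<close> meets
  \<open>B\<close>, or \<open>U\<close> and \<open>V\<close> differ in size.\<close>

lemma exchange_poly_eq_sum:
  "exchange_poly M r A B X Y =
     (\<Sum>(U, V)\<in>(\<Union>u. exchange_pairs A B X Y u). monom (exchange_prod M A B U V) (card U))"
proof -
  let ?G = "\<Union>u. exchange_pairs A B X Y u" and ?c = "label_col r A B" and ?p = "place r A B"
  let ?M = "map_mat coeff_lift M" and ?f = "top_weight A X :: _ \<Rightarrow> 'a poly" and ?g = "bottom_weight B Y :: _ \<Rightarrow> 'a poly"
  let ?t = "\<lambda>U V. (\<Prod>x\<in>A - U. ?f (Inl x)) * (\<Prod>y\<in>V. ?f (Inr y)) * ((\<Prod>x\<in>U. ?g (Inl x)) * (\<Prod>y\<in>B - V. ?g (Inr y))) *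
       det (split_mat ?M r ?c (?p ` ((A - U) <+> V)))"
  note fin = finite_AB
  have G: "(U, V) \<in> ?G \<longleftrightarrow> U \<subseteq> A - B \<and> X \<subseteq> U \<and> V \<subseteq> B - A \<and> Y \<subseteq> V \<and> card U = card V" for U V
    by (auto simp: exchange_pairs_def)
  have zero: "?t U V = 0" if U: "U \<subseteq> A" and V: "V \<subseteq> B" and notG: "(U, V) \<notin> ?G" for U V
  proof -
    have finUV: "finite U" "finite V" using U V fin finite_subset by auto
    have "\<not> (X \<subseteq> U \<and> V \<inter> A = {} \<and> Y \<subseteq> V \<and> U \<inter> B = {} \<and> card U = card V)"
      using notG U V unfolding G by auto
    then consider (X) "\<not> X \<subseteq> U" | (V) "V \<inter> A \<noteq> {}" | (Y) "\<not> Y \<subseteq> V"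
      | (U) "U \<inter> B \<noteq> {}" "V \<inter> A = {}" | (card) "card U \<noteq> card V"
      by argo
    then show ?thesis
    proof cases
      case X
      then have "(\<Prod>x\<in>A - U. ?f (Inl x)) = 0"
        using \<open>X \<subseteq> A - B\<close> fin by (intro prod_zero) (auto simp: top_weight_def)
      then show ?thesis by simp
    next
      case V
      then have "(\<Prod>y\<in>V. ?f (Inr y)) = 0"
        using finUV by (intro prod_zero) (auto simp: top_weight_def)
      then show ?thesis by simp
    next
      case Y
      then have "(\<Prod>y\<in>B - V. ?g (Inr y)) = 0"
        using \<open>Y \<subseteq> B - A\<close> fin by (intro prod_zero) (auto simp: bottom_weight_def)
      then show ?thesis by simp
    next
      case U
      \<comment> \<open>Both occurrences of such an \<open>x\<close> stand in the lower half and
        give two equal columns.\<close>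
      then obtain x where x: "x \<in> U" "x \<in> A" "x \<in> B" "x \<notin> V" using \<open>U \<subseteq> A\<close> by auto
      let ?i = "?p (Inl x)" and ?j = "?p (Inr x)"
      have S: "(A - U) <+> V \<subseteq> A <+> B" using \<open>U \<subseteq> A\<close> \<open>V \<subseteq> B\<close> by auto
      have ij: "Inl x \<in> A <+> B" "Inr x \<in> A <+> B" using x by auto
      note l = label_place[OF fin card ij(1)] label_place[OF fin card ij(2)]
      have "?i \<notin> ?p ` ((A - U) <+> V)" "?j \<notin> ?p ` ((A - U) <+> V)"
        unfolding place_image_eq[OF fin card S] using l x by auto
      then have "det (split_mat ?M r ?c (?p ` ((A - U) <+> V))) = 0"
        using place_less[OF fin card ij(1)] place_less[OF fin card ij(2)] l
        by (intro det_stack_mat_identical[of ?i r ?j]) auto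
      then show ?thesis by simp
    next
      case card
      let ?S = "(A - U) <+> V"
      have S: "?S \<subseteq> A <+> B" using \<open>U \<subseteq> A\<close> \<open>V \<subseteq> B\<close> by auto
      have "card (?p ` ?S) = card ?S"
        using inj_on_subset[OF inj_on_place[OF fin \<open>card A = r\<close> \<open>card B = r\<close>] S] by (rule card_image)
      also have "\<dots> = (r - card U) + card V"
        using fin finUV U \<open>card A = r\<close> by (simp add: card_Plus card_Diff_subset)
      finally have "card (?p ` ?S) \<noteq> r"
        using card card_mono[OF fin(1) U] \<open>card A = r\<close> by linarith
      then have "det (split_mat ?M r ?c (?p ` ?S)) = 0"
        using place_less[OF fin \<open>card A = r\<close> \<open>card B = r\<close>] S by (intro det_split_mat_card_neq) auto
      then show ?thesis by simp
    qed
  qed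
  have "exchange_poly M r A B X Y = (\<Sum>(U, V)\<in>Pow A \<times> Pow B. ?t U V)"
    unfolding exchange_poly_def by (rule det_stack_mat_label[OF fin card])
  also have "\<dots> = (\<Sum>(U, V)\<in>?G. monom (exchange_prod M A B U V) (card U))"
  proof (rule sum.mono_neutral_cong_right)
    show "\<forall>i\<in>Pow A \<times> Pow B - ?G. (case i of (U, V) \<Rightarrow> ?t U V) = 0"
      using zero by auto
  next
    fix z assume "z \<in> ?G"
    then obtain U V where z: "z = (U, V)" and "(U, V) \<in> ?G" by (cases z) auto
    then have U: "U \<subseteq> A" "U \<inter> B = {}" "X \<subseteq> U" and V: "V \<subseteq> B" "V \<inter> A = {}" "Y \<subseteq> V"
      and UV: "card U = card V"
      unfolding G by auto
    have "(\<Prod>x\<in>A - U. ?f (Inl x)) = 1" "(\<Prod>y\<in>V. ?f (Inr y)) = 1" "(\<Prod>y\<in>B - V. ?g (Inr y)) = 1"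
      using U V by (auto intro!: prod.neutral simp: top_weight_def bottom_weight_def)
    moreover have "(\<Prod>x\<in>U. ?g (Inl x)) = (\<Prod>x\<in>U. - [:0, 1:])"
      using U by (intro prod.cong) (auto simp: bottom_weight_def)
    moreover have "det (split_mat ?M r ?c (?p ` ((A - U) <+> V))) = (-1) ^ card U * [:exchange_prod M A B U V:]"
      using M by (subst det_split_mat_exchange[OF fin card _ U(1) V(1) UV, of _ n])
        (auto simp: exchange_prod_coeff_lift[OF M A B U(1) V(1) UV card])
    ultimately have "?t U V = (- [:0, 1:]) ^ card U * ((-1) ^ card U * [:exchange_prod M A B U V:])"
      by simp
    \<comment> \<open>The factors -t from the lower weights of \<open>U\<close> absorb the sign of
      the exchange.\<close>
    also have "\<dots> = (- [:0, 1:] * -1) ^ card U * [:exchange_prod M A B U V:]"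
      by (simp only: power_mult_distrib mult.assoc)
    also have "\<dots> = monom (exchange_prod M A B U V) (card U)"
      by (simp add: monom_altdef)
    finally show "(case z of (U, V) \<Rightarrow> ?t U V) = (case z of (U, V) \<Rightarrow> monom (exchange_prod M A B U V) (card U))"
      by (simp only: z prod.case)
  qed (use fin in \<open>auto simp: exchange_pairs_def\<close>)
  finally show ?thesis .
qed

lemma coeff_exchange_poly:
  "coeff (exchange_poly M r A B X Y) u = (\<Sum>(U, V)\<in>exchange_pairs A B X Y u. exchange_prod M A B U V)"
proof -
  have "finite (\<Union>u. exchange_pairs A B X Y u)"
    by (rule finite_subset[of _ "Pow A \<times> Pow B"]) (use finite_AB in \<open>auto simp: exchange_pairs_def\<close>)
  then show ?thesis
    unfolding exchange_poly_eq_sum coeff_sum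
    by (intro sum.mono_neutral_cong_right) (auto simp: exchange_pairs_def split: if_splits)
qed

text \<open>After the row operations, each Leibniz summand is examined in the last
  \<open>r - s\<close> rows. At most \<open>card (A \<inter> B)\<close> of them use a second
  occurrence of a common column; each of the others supplies a factor divisible by 1 + t, and there
  are at least \<open>card (A - B) - s\<close> of these.\<close>

lemma one_plus_X_power_dvd_exchange_poly:
  "[:1, 1:] ^ (card (A - B) - vec_space.rank r (col_submatrix M (X \<union> Y))) dvd exchange_poly M r A B X Y"
proof -
  let ?K = "col_submatrix M (X \<union> Y)" and ?c = "label_col r A B" and ?l = "label r A B"
  define s where "s = vec_space.rank r ?K"
  have XY: "X \<union> Y \<subseteq> {..<n}" using X Y A B by auto
  then have dim: "{j. j < dim_col M \<and> j \<in> X \<union> Y} = X \<union> Y" using M by auto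
  have K: "?K \<in> carrier_mat r (card (X \<union> Y))"
    using M unfolding col_submatrix_def by (intro carrier_matI) (simp_all only: dim_submatrix dim, auto)
  from exists_invertible_rank_rows_zero[OF K] obtain P where P: "P \<in> carrier_mat r r" "det P \<noteq> 0"
    and PK: "\<And>i j. s \<le> i \<Longrightarrow> i < r \<Longrightarrow> j < card (X \<union> Y) \<Longrightarrow> (P * ?K) $$ (i, j) = 0"
    unfolding s_def by blast
  \<comment> \<open>The column \<open>x\<close> of \<open>M\<close> is found in the submatrix at the
    position of \<open>x\<close> in \<open>X \<union> Y\<close>.\<close>
  have PM: "(P * M) $$ (i, x) = 0" if i: "s \<le> i" "i < r" and x: "x \<in> X \<union> Y" for i x
  proof -
    let ?j = "card {a \<in> X \<union> Y. a < x}"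
    have "finite (X \<union> Y)" using XY finite_subset by blast
    then have j: "?j < card (X \<union> Y)" using x by (intro psubset_card_mono) auto
    have "x < n" using x XY by auto
    have "?K $$ (k, ?j) = M $$ (k, x)" if "k < r" for k
      using submatrix_index_card[of k M x UNIV "X \<union> Y"] that x \<open>x < n\<close> M
      unfolding col_submatrix_def by simp
    then have "col ?K ?j = col M x"
      using K M j \<open>x < n\<close> by (intro eq_vecI) auto
    then show ?thesis using PK[OF i j] i j P K M \<open>x < n\<close> by simp
  qed
  let ?M = "map_mat coeff_lift M" and ?P = "map_mat coeff_lift P"
  let ?\<alpha> = "\<lambda>j. top_weight A X (?l j) :: 'a poly" and ?\<beta> = "\<lambda>j. bottom_weight B Y (?l j) :: 'a poly"
  let ?N = "mat (2 * r) (2 * r) (\<lambda>(i, j). if i < r then ?\<alpha> j * ?M $$ (i, ?c j)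
           else (?\<beta> j - ?\<alpha> j) * (?P * ?M) $$ (i - r, ?c j))"
  have c: "?c j < n" if "j < 2 * r" for j
    using label_mem[OF finite_AB card that] A B by auto
  have PM': "?P * ?M = map_mat coeff_lift (P * M)"
    using coeff_lift_hom.mat_hom_mult[OF P(1) M] by simp
  let ?L = "four_block_mat (1\<^sub>m r) (0\<^sub>m r r) (- ?P) ?P"
  have P': "?P \<in> carrier_mat r r" and M': "?M \<in> carrier_mat r n" using P M by auto
  have "?L \<in> carrier_mat (2 * r) (2 * r)"
    unfolding mult_2 by (rule four_block_carrier_mat) (use P in auto)
  then have "det (?L * stack_mat ?M r ?c ?\<alpha> ?\<beta>) = det ?L * det (stack_mat ?M r ?c ?\<alpha> ?\<beta>)"
    by (rule det_mult) (rule stack_mat_carrier)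
  moreover have "?L * stack_mat ?M r ?c ?\<alpha> ?\<beta> = ?N"
    by (rule subtract_rows_mat_mult_stack_mat[OF P' M' c])
  moreover have "det ?L = [:det P:]"
    using det_subtract_rows_mat[OF P'] by simp
  ultimately have N: "smult (det P) (exchange_poly M r A B X Y) = det ?N"
    by (simp add: exchange_poly_def)
  have "[:1, 1:] ^ (card (A - B) - s) dvd (\<Prod>i = 0..<2 * r. ?N $$ (i, p i))"
    if p: "p permutes {0..<2 * r}" for p
  proof -
    define R where "R = {r + s..<2 * r}"
    \<comment> \<open>For second occurrences the weights are (0, 1), with difference 1: these are
      the only columns without a guaranteed factor 1 + t in the rows \<open>R\<close>.\<close>
    define Z where "Z = {i \<in> R. ?l (p i) \<in> Inr ` (A \<inter> B)}"
    have p_less: "p i < 2 * r" if "i \<in> R" for i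
      using that permutes_in_image[OF p, of i] by (simp add: R_def)
    have "inj_on (\<lambda>i. ?l (p i)) R"
      by (rule inj_on_inverseI[of _ "Hilbert_Choice.inv p \<circ> place r A B"])
        (use p_less place_label[OF finite_AB card] permutes_inverses(2)[OF p] in simp)
    then have "card Z \<le> card (Inr ` (A \<inter> B) :: (nat + nat) set)"
      using finite_AB by (intro card_inj_on_le[of "\<lambda>i. ?l (p i)"]) (auto simp: Z_def intro: inj_on_subset)
    then have "card Z \<le> card (A \<inter> B)"
      by (simp add: card_image)
    moreover have "card (A - B) = r - card (A \<inter> B)" "card (A \<inter> B) \<le> r"
      using card finite_AB by (auto simp: card_Diff_subset_Int intro: card_mono)
    moreover have "card (R - Z) = card R - card Z" "card R = r - s"
      by (subst card_Diff_subset) (auto simp: R_def Z_def)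
    ultimately have "card (A - B) - s \<le> card (R - Z)" by linarith
    then have "[:1, 1:] ^ (card (A - B) - s) dvd ([:1, 1:] ^ card (R - Z) :: 'a poly)"
      by (rule le_imp_power_dvd)
    also have "\<dots> = (\<Prod>i\<in>R - Z. [:1, 1:])" by simp
    also have "\<dots> dvd (\<Prod>i\<in>R - Z. ?N $$ (i, p i))"
    proof (rule prod_dvd_prod)
      fix i assume i: "i \<in> R - Z"
      then have i': "s \<le> i - r" "i - r < r" "r \<le> i" "i < 2 * r" by (auto simp: R_def)
      have pi: "p i < 2 * r" using p_less i by simp
      have N_i: "?N $$ (i, p i) = (?\<beta> (p i) - ?\<alpha> (p i)) * [:(P * M) $$ (i - r, ?c (p i)):]"
        unfolding PM' using i' pi P M c by simp
      \<comment> \<open>Columns in \<open>X \<union> Y\<close> vanish by the choice of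
        \<open>P\<close>. Otherwise the difference of the weights is -(1 + t) on
        \<open>A - B - X\<close>, and 0 on \<open>B - A - Y\<close> and on first occurrences of
        \<open>A \<inter> B\<close>.\<close>
      have "(P * M) $$ (i - r, ?c (p i)) = 0 \<or> [:1, 1:] dvd ?\<beta> (p i) - ?\<alpha> (p i)"
      proof (cases "?l (p i)")
        case (Inl x)
        have "- [:0, 1:] - 1 = (- [:1, 1:] :: 'a poly)" 
          by (rule poly_eqI) (auto simp: coeff_pCons split: nat.split)
        then have d: "[:1, 1:] dvd (- [:0, 1:] - 1 :: 'a poly)" by (metis dvd_minus_iff dvd_refl)
        consider "x \<in> X" | "x \<notin> X" "x \<in> B" | "x \<notin> X" "x \<notin> B" by blast
        then show ?thesis
        proof cases
          case 3
          then have "?\<beta> (p i) - ?\<alpha> (p i) = - [:0, 1:] - 1"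
            by (simp only: Inl top_weight_def bottom_weight_def sum.case if_False)
          then show ?thesis using d by (simp only: simp_thms)
        qed (use Inl PM[OF i'(1,2), of x] X in \<open>auto simp: top_weight_def bottom_weight_def\<close>)
      next
        case (Inr y)
        have "?l (p i) \<notin> Inr ` (A \<inter> B)" using i by (simp add: Z_def)
        then have "y \<notin> A" using Inr label_mem[OF finite_AB card pi] by auto
        then show ?thesis
          using Inr PM[OF i'(1,2), of y] by (auto simp: top_weight_def bottom_weight_def)
      qed
      then show "[:1, 1:] dvd ?N $$ (i, p i)"
        unfolding N_i
      proof
        assume "(P * M) $$ (i - r, ?c (p i)) = 0"
        then show "[:1, 1:] dvd (?\<beta> (p i) - ?\<alpha> (p i)) * [:(P * M) $$ (i - r, ?c (p i)):]"
          by simp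
      qed (rule dvd_mult2)
    qed
    also have "\<dots> dvd (\<Prod>i = 0..<2 * r. ?N $$ (i, p i))"
      by (rule prod_dvd_prod_subset) (auto simp: R_def)
    finally show ?thesis .
  qed
  then have "[:1, 1:] ^ (card (A - B) - s) dvd det ?N"
    by (subst det_def'[of _ "2 * r"]) (auto intro!: dvd_sum dvd_mult)
  then have "[:1, 1:] ^ (card (A - B) - s) dvd exchange_poly M r A B X Y"
    unfolding N[symmetric] using P(2) by (rule dvd_smult_cancel)
  then show ?thesis unfolding s_def .
qed

end

section \<open>Comparison of the coefficients of D(t)\<close>

theorem theorem5p2:
  fixes M :: "'a :: field mat" and r n :: nat and A B X Y :: "nat set"
  assumes "M \<in> carrier_mat r n"
    and "A \<subseteq> {..<n}" and "B \<subseteq> {..<n}"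
    and "card A = r" and "card B = r"
    and "X \<subseteq> A - B" and "Y \<subseteq> B - A"
  shows "exchange_prod M A B {} {} =
    (\<Sum>u = max (card X) (card Y)..vec_space.rank r (col_submatrix M (X \<union> Y)).
       of_int (gen_binomial
          (int (vec_space.rank r (col_submatrix M (X \<union> Y))) - int (card (A - B)))
          (int (vec_space.rank r (col_submatrix M (X \<union> Y))) - int u)) *
       (\<Sum>(U, V) \<in> {(U, V). U \<subseteq> A - B \<and> card U = u \<and> X \<subseteq> U \<and>
                          V \<subseteq> B - A \<and> card V = u \<and> Y \<subseteq> V}.
          exchange_prod M A B U V))"
proof -
  let ?s = "vec_space.rank r (col_submatrix M (X \<union> Y))" and ?k = "card (A - B)"
  let ?D = "exchange_poly M r A B X Y" and ?m = "max (card X) (card Y)"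
  let ?b = "\<lambda>u. of_int (gen_binomial (int ?s - int ?k) (int ?s - int u)) :: 'a"
  note fin = finite_AB[OF assms]
  have k: "card (B - A) = ?k"
    using assms(4,5) fin by (metis card_le_sym_Diff dual_order.antisym order_refl)
  have finAB: "finite (A - B)" "finite (B - A)" using fin by auto
  have coeff: "coeff ?D u = (\<Sum>(U, V)\<in>exchange_pairs A B X Y u. exchange_prod M A B U V)" for u
    by (rule coeff_exchange_poly[OF assms])
  have pairs: "?m \<le> u \<and> u \<le> ?k" if "(U, V) \<in> exchange_pairs A B X Y u" for U V u
    using that finAB card_mono[of U X] card_mono[of V Y] card_mono[of "A - B" U]
      finite_subset[of U "A - B"] finite_subset[of V "B - A"]
    by (simp add: exchange_pairs_def)
  have "exchange_pairs A B X Y u = {}" if "u < ?m \<or> ?k < u" for u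
    using that pairs[of _ _ u] by fastforce
  then have zero: "coeff ?D u = 0" if "u < ?m \<or> ?k < u" for u
    using that unfolding coeff by simp
  \<comment> \<open>At \<open>u = ?k\<close> only the complete exchange remains, so the top
    coefficient is the left-hand side of the theorem.\<close>
  have "z = (A - B, B - A)" if "z \<in> exchange_pairs A B X Y ?k" for z
    using that card_subset_eq[OF finAB(1), of "fst z"] card_subset_eq[OF finAB(2), of "snd z"] k
    by (cases z) (simp add: exchange_pairs_def)
  moreover have "(A - B, B - A) \<in> exchange_pairs A B X Y ?k"
    using assms(6,7) k by (simp add: exchange_pairs_def)
  ultimately have "exchange_pairs A B X Y ?k = {(A - B, B - A)}" by blast
  then have top: "coeff ?D ?k = exchange_prod M A B {} {}"
    using exchange_prod_swap_all[OF fin assms(4,5,1)] by (simp add: coeff)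
  have "(\<Sum>u = ?m..?s. ?b u * coeff ?D u) = coeff ?D ?k"
  proof (cases "?k \<le> ?s")
    case True
    have "?m \<le> ?k" using card_mono[OF finAB(1) assms(6)] card_mono[OF finAB(2) assms(7)] k by simp
    have "(\<Sum>u = ?m..?s. ?b u * coeff ?D u) = (\<Sum>u = ?m..?s. if u = ?k then coeff ?D u else 0)"
    \<comment> \<open>For \<open>u < ?k\<close> the lower index \<open>?s - u\<close> exceeds
      \<open>?s - ?k\<close>, so the binomial vanishes; for \<open>u > ?k\<close> the coefficient of
      D does.\<close>
    proof (intro sum.cong refl)
      fix u assume "u \<in> {?m..?s}"
      then have "?b u = of_nat ((?s - ?k) choose (?s - u))"
        using gen_binomial_nonneg[of "int ?s - int ?k" "?s - u"] True
        by (simp add: of_nat_diff nat_diff_distrib)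
      then show "?b u * coeff ?D u = (if u = ?k then coeff ?D u else 0)"
        using zero[of u] True \<open>u \<in> {?m..?s}\<close> by (cases u ?k rule: linorder_cases) (auto simp: binomial_eq_0)
    qed
    also have "\<dots> = coeff ?D ?k" using True \<open>?m \<le> ?k\<close> by simp
    finally show ?thesis .
  next
    case False
    obtain p where p: "?D = [:1, 1:] ^ (?k - ?s) * p"
      using one_plus_X_power_dvd_exchange_poly[OF assms] by (rule dvdE)
    \<comment> \<open>The coefficients below \<open>?m\<close> are 0. This also covers
      \<open>?s < ?m\<close>, where the left sum is empty.\<close>
    have "(\<Sum>u = ?m..?s. ?b u * coeff ?D u) = (\<Sum>u\<le>?s. ?b u * coeff ?D u)"
    proof (intro sum.mono_neutral_left ballI)
      fix u assume "u \<in> {..?s} - {?m..?s}"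
      then have "u < ?m" by auto
      then show "?b u * coeff ?D u = 0" using zero[of u] by simp
    qed auto
    also have "\<dots> = (\<Sum>u\<le>?s. of_int (gen_binomial (- int (?k - ?s)) (int (?s - u))) * coeff ?D u)"
    proof (intro sum.cong refl)
      fix u assume "u \<in> {..?s}"
      then have "int ?s - int u = int (?s - u)" "int ?s - int ?k = - int (?k - ?s)"
        using False by auto
      then show "?b u * coeff ?D u =
          of_int (gen_binomial (- int (?k - ?s)) (int (?s - u))) * coeff ?D u"
        by (simp only:)
    qed
    also have "\<dots> = coeff p ?s"
      using coeff_quotient_one_plus_X_power[OF p] by simp
    \<comment> \<open>Here \<open>?k - ?s + ?s\<close> is \<open>?k\<close>, which bounds the degree
      of D, so the coefficient of the quotient at \<open>?s\<close> is that of D at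
      \<open>?k\<close>.\<close>
    also have "\<dots> = coeff ([:1, 1:] ^ (?k - ?s) * p) (?k - ?s + ?s)"
    proof (rule coeff_one_plus_X_power_mult[symmetric])
      have "degree ?D \<le> ?k" using zero by (intro degree_le) auto
      then show "degree ([:1, 1:] ^ (?k - ?s) * p) \<le> ?k - ?s + ?s" using False p by simp
    qed
    also have "\<dots> = coeff ?D ?k" using False p by simp
    finally show ?thesis .
  qed
  then have "exchange_prod M A B {} {} = (\<Sum>u = ?m..?s. ?b u * coeff ?D u)"
    unfolding top by (rule sym)
  then show ?thesis
    unfolding coeff exchange_pairs_def .
qed

end
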